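(* Let $n\geq 1$ and let $F\colon\mathbb{F}_2^n\to\mathbb{F}_2^n$ be an APN function. Then there exists a Sidon set in $\mathbb{F}_2^{2n-1}$ of size $2^{n-1}+\frac{\mathcal{L}(F)}{2}$.
   Context: A subset $M\subseteq\mathbb{F}_2^t$ is called a Sidon set if the sum of any four distinct elements of $M$ is different from $0$. A function $F\colon\mathbb{F}_2^n\to\mathbb{F}_2^n$ is almost perfect nonlinear (APN) if for every $a\in\mathbb{F}_2^n\setminus\{0\}$ and every $b\in\mathbb{F}_2^n$ the equation $F(x)+F(x+a)=b$ has at most $2$ solutions $x\in\mathbb{F}_2^n$. With $\cdot$ the usual inner product on $\mathbb{F}_2^n$, the Walsh transform of $F$ is $W_F(a,b)=\sum_{x\in\mathbb{F}_2^n}(-1)^{a\cdot x+b\cdot F(x)}\in\mathbb{Z}$, and the linearity of $F$ is $\mathcal{L}(F)=\max_{a\in\mathbb{F}_2^n,\ b\in\mathbb{F}_2^n\setminus\{0\}}|W_F(a,b)|$. *)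

theory Defs
  imports "HOL-Analysis.Finite_Cartesian_Product" "HOL-Library.Z2"
begin

text \<open>The type \<^typ>\<open>bit\<close> is the field with two elements; the space of dimension \<open>t\<close>
  over it is \<open>bit ^ 't\<close> for any index type \<open>'t\<close> with \<open>CARD('t) = t\<close>.\<close>

instance bit :: finite
proof
  have "(UNIV :: bit set) = {0, 1}"
    by auto
  then show "finite (UNIV :: bit set)"
    by (metis finite.emptyI finite.insertI)
qed

definition sidon :: "(bit ^ 't) set \<Rightarrow> bool" where
  "sidon M \<longleftrightarrow>
     (\<forall>w\<in>M. \<forall>x\<in>M. \<forall>y\<in>M. \<forall>z\<in>M. distinct [w, x, y, z] \<longrightarrow> w + x + y + z \<noteq> 0)"

definition APN :: "(bit ^ 'n \<Rightarrow> bit ^ 'n) \<Rightarrow> bool" where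
  "APN F \<longleftrightarrow> (\<forall>a b. a \<noteq> 0 \<longrightarrow> card {x. F x + F (x + a) = b} \<le> 2)"

text \<open>The exponent is computed in the two-element field and then read as 0 or 1.\<close>

definition walsh :: "(bit ^ 'n \<Rightarrow> bit ^ 'n) \<Rightarrow> bit ^ 'n \<Rightarrow> bit ^ 'n \<Rightarrow> int" where
  "walsh F a b =
     (\<Sum>x\<in>UNIV. (- 1) ^ (of_bit (scalar_product a x + scalar_product b (F x)) :: nat))"

definition linearity :: "(bit ^ 'n \<Rightarrow> bit ^ 'n) \<Rightarrow> int" where
  "linearity F = Max {\<bar>walsh F a b\<bar> | a b. b \<noteq> 0}"

end

theory Submission
  imports Defs
begin

text \<open>The graph of an APN function \<open>F\<close> is a Sidon set in dimension \<open>2 * n\<close>. If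
  \<open>(a, b)\<close> attains the linearity, the affine hyperplane \<open>a \<bullet> x + b \<bullet> y = c\<close> contains,
  for a suitable \<open>c\<close>, exactly \<open>2 ^ (n - 1) + \<L>(F) / 2\<close> points of the graph. Choose \<open>j\<close>
  with \<open>b $ j = 1\<close>: forgetting the coordinate \<open>y $ j\<close> is injective on this hyperplane and
  turns these points into a Sidon set in dimension \<open>2 * n - 1\<close>.\<close>

lemma bit_add_self: "(x :: bit) + x = 0"
  by (cases x) simp_all

lemma bit_vec_add_self: "(x :: bit ^ 'n) + x = 0"
  by (simp add: vec_eq_iff bit_add_self)

lemma bit_vec_add_cancel: "(x :: bit ^ 'n) + y = 0 \<longleftrightarrow> x = y"
  by (metis add.right_neutral add.left_commute bit_vec_add_self)

lemma scalar_product_add: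
  fixes a :: "'a::comm_semiring_1 ^ 'n"
  shows "scalar_product a (x + y) = scalar_product a x + scalar_product a y"
  by (simp add: scalar_product_def distrib_left sum.distrib)

text \<open>If both sums vanished, then for the nonzero direction \<open>w + x\<close> the distinct
  points \<open>w\<close>, \<open>x\<close> and \<open>y\<close> would all solve
  \<open>F v + F (v + (w + x)) = F w + F x\<close>, one more solution than APN allows.\<close>

lemma APN_graph_sidon:
  fixes F :: "bit ^ 'n \<Rightarrow> bit ^ 'n"
  assumes "APN F" and d: "distinct [w, x, y, z]" and s: "w + x + y + z = 0"
  shows "F w + F x + F y + F z \<noteq> 0"
proof
  assume f: "F w + F x + F y + F z = 0"
  have "w + x \<noteq> 0"
    using d by (simp add: bit_vec_add_cancel)
  then have le: "card {v. F v + F (v + (w + x)) = F w + F x} \<le> 2"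
    using \<open>APN F\<close> by (simp add: APN_def)
  have w: "w + (w + x) = x" and x: "x + (w + x) = w"
    by (metis add.assoc add.commute add.right_neutral bit_vec_add_self)+
  have y: "y + (w + x) = z" and f': "F y + F z = F w + F x"
    using s f by (metis add.assoc add.commute bit_vec_add_cancel)+
  have "{w, x, y} \<subseteq> {v. F v + F (v + (w + x)) = F w + F x}"
    using w x y f' by (auto simp: add.commute)
  then have "card {w, x, y} \<le> 2"
    using le card_mono[OF finite] by (meson le_trans)
  then show False
    using d by auto
qed

lemma card_bit_vec: "CARD(bit ^ 'n) = 2 ^ CARD('n::finite)"
proof -
  have "(UNIV :: bit set) = {0, 1}"
    by auto
  then have "CARD(bit) = 2"
    by (metis card_2_iff zero_neq_one)
  then show ?thesis
    by simp
qed

text \<open>The two fibres of the exponent partition the space, and \<open>walsh F a b\<close> is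
  the difference of their sizes. Adding its absolute value to the total gives twice the larger
  fibre, so \<open>c\<close> is the value taken on that one.\<close>

lemma card_half_walsh:
  fixes F :: "bit ^ 'n \<Rightarrow> bit ^ 'n"
  obtains c where
    "2 * int (card {x. scalar_product a x + scalar_product b (F x) = c})
      = 2 ^ CARD('n) + \<bar>walsh F a b\<bar>"
proof -
  define A where "A c = {x. scalar_product a x + scalar_product b (F x) = c}" for c
  have un: "A 0 \<union> A 1 = UNIV" and dj: "A 0 \<inter> A 1 = {}"
    unfolding A_def by auto
  have "card (A 0) + card (A 1) = 2 ^ CARD('n)"
    by (metis un dj card_Un_disjoint finite card_bit_vec)
  then have tot: "int (card (A 0)) + int (card (A 1)) = 2 ^ CARD('n)"
    by (metis of_nat_add of_nat_numeral of_nat_power)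
  have "walsh F a b = (\<Sum>x\<in>A 0 \<union> A 1.
      (- 1) ^ (of_bit (scalar_product a x + scalar_product b (F x)) :: nat))"
    by (simp only: un walsh_def)
  also have "\<dots> = (\<Sum>x\<in>A 0. 1) + (\<Sum>x\<in>A 1. - 1)"
    by (subst sum.union_disjoint) (use dj in \<open>auto simp: A_def intro!: sum.cong arg_cong2[where f = "(+)"]\<close>)
  finally have "walsh F a b = int (card (A 0)) - int (card (A 1))"
    by simp
  with tot have "2 * int (card (A 0)) = 2 ^ CARD('n) + \<bar>walsh F a b\<bar>
      \<or> 2 * int (card (A 1)) = 2 ^ CARD('n) + \<bar>walsh F a b\<bar>"
    by linarith
  then show thesis
    using that unfolding A_def by blast
qed

theorem corollary3p6:
  fixes F :: "bit ^ 'n \<Rightarrow> bit ^ 'n"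
  assumes "CARD('m::finite) = 2 * CARD('n) - 1"
    and "APN F"
  shows "\<exists>M :: (bit ^ 'm) set. sidon M \<and>
    real (card M) = 2 ^ (CARD('n) - 1) + real_of_int (linearity F) / 2"
proof -
  let ?W = "{\<bar>walsh F a b\<bar> | a b. b \<noteq> 0}"
  have "?W \<subseteq> (\<lambda>(a, b). \<bar>walsh F a b\<bar>) ` UNIV"
    by auto
  then have "finite ?W"
    by (rule finite_subset) simp
  \<comment> \<open>The all-ones vector serves as a nonzero \<open>b\<close>, so the maximum is
    taken over a nonempty set and is attained.\<close>
  moreover have "(\<chi> i. 1) \<noteq> (0 :: bit ^ 'n)"
    by (simp add: vec_eq_iff)
  then have "?W \<noteq> {}"
    by blast
  ultimately have "linearity F \<in> ?W"
    unfolding linearity_def by (rule Max_in)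
  then obtain a b where lin: "linearity F = \<bar>walsh F a b\<bar>" and "b \<noteq> 0"
    by blast
  then obtain j where j: "b $ j = 1"
    by (auto simp: vec_eq_iff)
  obtain c where c: "2 * int (card {x. scalar_product a x + scalar_product b (F x) = c})
      = 2 ^ CARD('n) + \<bar>walsh F a b\<bar>"
    using card_half_walsh .
  define H where "H = {x. scalar_product a x + scalar_product b (F x) = c}"
  \<comment> \<open>\<open>'n + 'n\<close> indexes the coordinates of a graph point
    \<open>(x, F x)\<close>: \<open>Inl\<close> for \<open>x\<close>, \<open>Inr\<close> for
    \<open>F x\<close>. Without \<open>Inr j\<close> there remain as many indices as
    \<open>'m\<close> has.\<close>
  have "CARD('m) = card (UNIV - {Inr j :: 'n + 'n})"
    using assms(1) by (simp add: card_Diff_singleton)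
  then obtain g :: "'m \<Rightarrow> 'n + 'n" where g: "bij_betw g UNIV (UNIV - {Inr j})"
    using finite_same_card_bij[of "UNIV :: 'm set" "UNIV - {Inr j :: 'n + 'n}"] by auto
  define p :: "bit ^ 'n \<Rightarrow> bit ^ 'm"
    where "p x = (\<chi> k. case g k of Inl i \<Rightarrow> x $ i | Inr i \<Rightarrow> F x $ i)" for x
  have range_g: "\<exists>k. g k = s" if "s \<noteq> Inr j" for s
    using g that by (metis bij_betw_imp_surj_on Diff_iff UNIV_I imageE singletonD)
  have p_Inl: "\<exists>k. \<forall>x. p x $ k = x $ i" for i
  proof -
    obtain k where "g k = Inl i"
      using range_g by blast
    then show ?thesis
      by (intro exI[of _ k]) (simp add: p_def)
  qed
  have p_Inr: "\<exists>k. \<forall>x. p x $ k = F x $ i" if "i \<noteq> j" for i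
  proof -
    obtain k where "g k = Inr i"
      using range_g \<open>i \<noteq> j\<close> by blast
    then show ?thesis
      by (intro exI[of _ k]) (simp add: p_def)
  qed
  \<comment> \<open>Every coordinate of \<open>x\<close> survives in \<open>p x\<close>, so
    injectivity holds on the whole space.\<close>
  have "inj p"
    by (rule injI) (metis p_Inl vec_eq_iff)
  have "sidon (p ` H)"
    unfolding sidon_def
  proof safe
    fix w x y z
    assume H: "w \<in> H" "x \<in> H" "y \<in> H" "z \<in> H"
      and d: "distinct [p w, p x, p y, p z]" and s: "p w + p x + p y + p z = 0"
    have s': "p w $ k + p x $ k + p y $ k + p z $ k = 0" for k
      using s by (metis vector_add_component zero_index)
    have sum0: "w + x + y + z = 0"
      unfolding vec_eq_iff using p_Inl s' by (metis vector_add_component zero_index)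
    let ?v = "F w + F x + F y + F z"
    have off: "?v $ i = 0" if "i \<noteq> j" for i
      using p_Inr[OF that] s' by (metis vector_add_component)
    let ?q = "\<lambda>x. scalar_product a x + scalar_product b (F x)"
    \<comment> \<open>The dropped coordinate of \<open>?v\<close> is recovered from the hyperplane
      equation: four copies of \<open>c\<close> cancel in characteristic 2 and the part with
      \<open>a\<close> vanishes by \<open>sum0\<close>.\<close>
    have "scalar_product a (w + x + y + z) + scalar_product b ?v = ?q w + ?q x + ?q y + ?q z"
      by (simp only: scalar_product_add ac_simps)
    also have "\<dots> = c + c + c + c"
      using H unfolding H_def mem_Collect_eq by presburger
    finally have "scalar_product b ?v = 0"
      by (simp add: sum0 bit_add_self scalar_product_def)
    \<comment> \<open>As \<open>?v\<close> is zero off \<open>j\<close>, only the term at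
      \<open>j\<close> is left, and its coefficient is 1.\<close>
    moreover have "scalar_product b ?v = b $ j * ?v $ j + (\<Sum>i\<in>UNIV - {j}. b $ i * ?v $ i)"
      unfolding scalar_product_def by (rule sum.remove) auto
    moreover have "(\<Sum>i\<in>UNIV - {j}. b $ i * ?v $ i) = 0"
      by (rule sum.neutral) (metis DiffD2 insertI1 mult_zero_right off)
    ultimately have "?v $ j = 0"
      using j by (metis add.right_neutral mult_1)
    then have "?v = 0"
      using off by (metis vec_eq_iff zero_index)
    moreover have "distinct [w, x, y, z]"
      using d by auto
    ultimately show False
      using APN_graph_sidon[OF \<open>APN F\<close> _ sum0] by blast
  qed
  moreover have "real (card (p ` H)) = 2 ^ (CARD('n) - 1) + real_of_int (linearity F) / 2"
  proof -
    have "card (p ` H) = card H"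
      by (rule card_image) (meson \<open>inj p\<close> inj_on_subset subset_UNIV)
    moreover have "2 * real (card H) = 2 ^ CARD('n) + real_of_int (linearity F)"
      using arg_cong[OF c, of real_of_int] by (simp add: H_def lin)
    \<comment> \<open>Index types are nonempty, so the subtraction in the exponent is not
      truncated.\<close>
    moreover have "(2 :: real) ^ CARD('n) = 2 * 2 ^ (CARD('n) - 1)"
      by (metis power_eq_if zero_less_card_finite less_numeral_extra(3))
    ultimately show ?thesis
      by simp
  qed
  ultimately show ?thesis
    by blast
qed

end
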